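(* Let $L>0$, $\mu>0$, let $f:\mathbb{R}^d\to\mathbb{R}$ be convex and differentiable with $L$-Lipschitz continuous gradient, let $h:\mathbb{R}^d\to\mathbb{R}\cup\{+\infty\}$ be closed, proper and convex, and let $F=f+h$ have a nonempty set of global minimizers, with minimum value $F_*$. Let $x_1\in\mathbb{R}^d$, and suppose that $F$ satisfies the Polyak-Łojasiewicz inequality with constant $\mu$ on $X=\{x: F(x)\le F(x_1)\}$, i.e. $$d(0,\partial F(x))^2\ \ge\ 2\mu\,(F(x)-F_* )\qquad\text{for all }x\in X.$$ Let $\gamma\in(0,\tfrac{2}{L})$ and $x_2=\mathrm{prox}_{\gamma h}(x_1-\gamma\nabla f(x_1))$. Then: 1. If $\gamma\in\left(0,\frac{3}{2L}\right]$, then $$F(x_2)-F_*\le \frac{1}{2\gamma\mu+1}\,(F(x_1)-F_* ).$$ 2. If $\gamma\in\left(\frac{3}{2L},\frac{2}{L}\right)$, then $$F(x_2)-F_*\le \frac{(L\gamma-1)^2}{(L\gamma-1)^2-L\gamma^2\mu+2\gamma\mu}\,(F(x_1)-F_* ).$$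
   Context: $\|\cdot\|$ is the Euclidean norm on $\mathbb{R}^d$. For a closed proper convex function $g$, $\mathrm{prox}_{g}(x)=\operatorname{argmin}_{y\in\mathbb{R}^d}\{g(y)+\frac12\|y-x\|^2\}$. $\partial F(x)$ is the (Clarke) subdifferential, which here equals $\nabla f(x)+\partial h(x)$ with $\partial h$ the convex subdifferential. $d(0,S)=\inf_{s\in S}\|s\|$ for nonempty $S$, with the convention $d(0,\emptyset)=+\infty$. *)

theory Defs
  imports "HOL-Analysis.Analysis"
begin

definition epi :: "('a \<Rightarrow> ereal) \<Rightarrow> ('a \<times> real) set" where
  "epi g = {(x, r). g x \<le> ereal r}"

definition proper_fun :: "('a \<Rightarrow> ereal) \<Rightarrow> bool" where
  "proper_fun g \<longleftrightarrow> (\<forall>x. g x \<noteq> -\<infinity>) \<and> (\<exists>x. g x \<noteq> \<infinity>)"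

definition closed_fun :: "('a::euclidean_space \<Rightarrow> ereal) \<Rightarrow> bool" where
  "closed_fun g \<longleftrightarrow> closed (epi g)"

definition convex_fun :: "('a::euclidean_space \<Rightarrow> ereal) \<Rightarrow> bool" where
  "convex_fun g \<longleftrightarrow> convex (epi g)"

text \<open>For a closed proper convex \<open>g\<close> the minimizer exists and is unique, so the choice made by
  \<^const>\<open>arg_min\<close> is immaterial.\<close>

definition prox :: "('a::euclidean_space \<Rightarrow> ereal) \<Rightarrow> 'a \<Rightarrow> 'a" where
  "prox g x = (ARG_MIN (\<lambda>y. g y + ereal (1/2 * (norm (y - x))\<^sup>2)) y. True)"

text \<open>The Clarke subdifferential of an extended real-valued function is defined through the
  Clarke normal cone to its epigraph, that is, the polar of the Clarke tangent cone. It is empty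
  where the function is not finite.\<close>

definition clarke_tangent_cone :: "'b::real_normed_vector set \<Rightarrow> 'b \<Rightarrow> 'b set" where
  "clarke_tangent_cone C x = {v. \<forall>X t. (\<forall>n. X n \<in> C) \<and> X \<longlonglongrightarrow> x \<and> (\<forall>n. t n > 0) \<and> t \<longlonglongrightarrow> (0::real) \<longrightarrow>
     (\<exists>V. V \<longlonglongrightarrow> v \<and> (\<forall>n::nat. X n + t n *\<^sub>R V n \<in> C))}"

definition clarke_normal_cone :: "'b::real_inner set \<Rightarrow> 'b \<Rightarrow> 'b set" where
  "clarke_normal_cone C x = {w. \<forall>v\<in>clarke_tangent_cone C x. w \<bullet> v \<le> 0}"

definition clarke_subdifferential :: "('a::euclidean_space \<Rightarrow> ereal) \<Rightarrow> 'a \<Rightarrow> 'a set" where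
  "clarke_subdifferential F x =
     {v. \<bar>F x\<bar> \<noteq> \<infinity> \<and> (v, -1) \<in> clarke_normal_cone (epi F) (x, real_of_ereal (F x))}"

text \<open>The distance from the origin; in \<^typ>\<open>ereal\<close> the infimum of the empty set is \<open>\<infinity>\<close>.\<close>

definition dist_zero :: "'a::real_normed_vector set \<Rightarrow> ereal" where
  "dist_zero S = (INF s\<in>S. ereal (norm s))"

definition convex_subdifferential :: "('a::euclidean_space \<Rightarrow> ereal) \<Rightarrow> 'a \<Rightarrow> 'a set" where
  "convex_subdifferential g x = {v. \<bar>g x\<bar> \<noteq> \<infinity> \<and> (\<forall>y. g y \<ge> g x + ereal (v \<bullet> (y - x)))}"

text \<open>The Clarke subdifferential of \<open>f + h\<close> as in the two lemmas below is
  \<open>\<nabla>f(x) + \<partial>h(x)\<close>, with \<open>\<partial>h\<close> the convex subdifferential.\<close>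

lemma clarke_subdifferential_convex:
  fixes F :: "'a::euclidean_space \<Rightarrow> ereal"
  assumes conv: "convex_fun F"
  shows "clarke_subdifferential F x = convex_subdifferential F x"
proof (cases "\<bar>F x\<bar> = \<infinity>")
  case True
  then show ?thesis
    by (simp add: clarke_subdifferential_def convex_subdifferential_def)
next
  case False
  define a where "a = real_of_ereal (F x)"
  have Fx: "F x = ereal a"
    using False by (auto simp: a_def ereal_real)
  have tang: "z - (x, a) \<in> clarke_tangent_cone (epi F) (x, a)" if z: "z \<in> epi F" for z
    unfolding clarke_tangent_cone_def
  proof (intro CollectI allI impI, elim conjE)
    fix X and t :: "nat \<Rightarrow> real"
    assume X: "\<forall>n. X n \<in> epi F" "X \<longlonglongrightarrow> (x, a)" and t: "\<forall>n. t n > 0" "t \<longlonglongrightarrow> 0"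
    define V where "V n = (if t n \<le> 1 then z - X n else 0)" for n
    have ev: "eventually (\<lambda>n. t n < 1) sequentially"
      using t(2) by (rule order_tendstoD) simp
    have "(\<lambda>n. z - X n) \<longlonglongrightarrow> z - (x, a)"
      by (intro tendsto_intros X(2))
    then have "V \<longlonglongrightarrow> z - (x, a)"
      by (rule Lim_transform_eventually) (use ev in eventually_elim, auto simp: V_def)
    moreover have "X n + t n *\<^sub>R V n \<in> epi F" for n
    proof (cases "t n \<le> 1")
      case True
      have "(1 - t n) *\<^sub>R X n + t n *\<^sub>R z \<in> epi F"
        using conv X(1) z t(1) True less_imp_le[of 0 "t n"]
        unfolding convex_fun_def convex_alt by blast
      then show ?thesis
        using True by (simp add: V_def algebra_simps)
    qed (simp add: V_def X(1))
    ultimately show "\<exists>V. V \<longlonglongrightarrow> z - (x, a) \<and> (\<forall>n. X n + t n *\<^sub>R V n \<in> epi F)"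
      by blast
  qed
  show ?thesis
  proof (intro equalityI subsetI)
    fix v assume v: "v \<in> clarke_subdifferential F x"
    have "F x + ereal (v \<bullet> (y - x)) \<le> F y" for y
    proof (rule ereal_le_real)
      fix r assume "F y \<le> ereal r"
      then have "(y, r) - (x, a) \<in> clarke_tangent_cone (epi F) (x, a)"
        by (intro tang) (simp add: epi_def)
      then have "(v, -1) \<bullet> ((y, r) - (x, a)) \<le> 0"
        using v unfolding clarke_subdifferential_def clarke_normal_cone_def a_def by blast
      then show "F x + ereal (v \<bullet> (y - x)) \<le> ereal r"
        by (simp add: Fx)
    qed
    then show "v \<in> convex_subdifferential F x"
      using False by (simp add: convex_subdifferential_def)
  next
    fix v assume v: "v \<in> convex_subdifferential F x"
    have sub: "(v, -1) \<bullet> (z - (x, a)) \<le> 0" if z: "z \<in> epi F" for z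
    proof -
      obtain y r where z': "z = (y, r)" "F y \<le> ereal r"
        using z by (auto simp: epi_def)
      have "F x + ereal (v \<bullet> (y - x)) \<le> ereal r"
        using v z'(2) unfolding convex_subdifferential_def by (blast intro: order_trans)
      then show ?thesis
        by (simp add: z'(1) Fx)
    qed
    have "(v, -1) \<bullet> w \<le> 0" if w: "w \<in> clarke_tangent_cone (epi F) (x, a)" for w
    proof -
      have "(\<lambda>n. 1 / real (Suc n)) \<longlonglongrightarrow> 0"
        by (rule lim_1_over_n[THEN LIMSEQ_Suc])
      then obtain V where V: "V \<longlonglongrightarrow> w"
          "\<And>n. (x, a) + (1 / real (Suc n)) *\<^sub>R V n \<in> epi F"
        using w[unfolded clarke_tangent_cone_def, simplified, rule_format,
                of "\<lambda>_. (x, a)" "\<lambda>n. 1 / real (Suc n)"]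
        by (auto simp: epi_def Fx)
      have "(v, -1) \<bullet> V n \<le> 0" for n
      proof -
        have "(1 / real (Suc n)) * ((v, -1) \<bullet> V n) \<le> 0"
          using sub[OF V(2)[of n]] by (simp only: add_diff_cancel_left' inner_scaleR_right)
        then show ?thesis
          by (simp add: divide_le_0_iff del: of_nat_Suc)
      qed
      moreover have "(\<lambda>n. (v, -1) \<bullet> V n) \<longlonglongrightarrow> (v, -1) \<bullet> w"
        by (intro tendsto_intros V(1))
      ultimately show ?thesis
        by (meson LIMSEQ_le_const2)
    qed
    then show "v \<in> clarke_subdifferential F x"
      using False by (simp add: clarke_subdifferential_def clarke_normal_cone_def a_def)
  qed
qed

lemma clarke_subdifferential_sum:
  fixes f :: "'a::euclidean_space \<Rightarrow> real" and h F :: "'a \<Rightarrow> ereal"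
  assumes f: "convex_on UNIV f" and grad: "GDERIV f x :> g"
    and h: "convex_fun h"
    and F: "\<And>x. F x = ereal (f x) + h x"
  shows "clarke_subdifferential F x = (\<lambda>v. g + v) ` convex_subdifferential h x"
proof -
  have diff: "((\<lambda>t. (f (x + t *\<^sub>R d) - f x) / t) \<longlongrightarrow> g \<bullet> d) (at_right 0)" for d
  proof -
    have 1: "((\<lambda>t. x + t *\<^sub>R d) has_vector_derivative d) (at 0)"
      by (auto intro!: derivative_eq_intros)
    have 2: "(f has_derivative (\<lambda>k. k \<bullet> g)) (at (x + 0 *\<^sub>R d))"
      using grad by (simp add: gderiv_def inner_commute)
    have "((\<lambda>t. f (x + t *\<^sub>R d)) has_derivative (\<lambda>t. (t *\<^sub>R d) \<bullet> g)) (at 0)"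
      using has_derivative_compose[OF 1[unfolded has_vector_derivative_def] 2] .
    then have "((\<lambda>t. f (x + t *\<^sub>R d)) has_field_derivative (g \<bullet> d)) (at 0)"
      unfolding has_field_derivative_def
      by (rule has_derivative_eq_rhs) (auto simp: inner_commute)
    then have "((\<lambda>t. (f (x + t *\<^sub>R d) - f x) / t) \<longlongrightarrow> g \<bullet> d) (at 0)"
      by (simp add: DERIV_def)
    then show ?thesis
      by (rule filterlim_mono) (auto simp: at_le)
  qed
  have f_le: "f (x + t *\<^sub>R (y - x)) \<le> f x + t * (f y - f x)" if "0 \<le> t" "t \<le> 1" for t y
  proof -
    have "f ((1 - t) *\<^sub>R x + t *\<^sub>R y) \<le> (1 - t) * f x + t * f y"
      using convex_onD[OF f, of t x y] that by simp
    then show ?thesis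
      by (simp add: algebra_simps)
  qed
  have h_le: "h (x + t *\<^sub>R (y - x)) \<le> ereal (a + t * (b - a))"
    if "0 \<le> t" "t \<le> 1" "h x \<le> ereal a" "h y \<le> ereal b" for t y a b
  proof -
    have "(1 - t) *\<^sub>R (x, a) + t *\<^sub>R (y, b) \<in> epi h"
      using h that unfolding convex_fun_def convex_alt by (auto simp: epi_def)
    then show ?thesis
      by (simp add: epi_def algebra_simps)
  qed
  have small: "eventually (\<lambda>t::real. 0 < t \<and> t < 1) (at_right 0)"
    using eventually_at_right_real[of 0 1] by (auto elim: eventually_mono)
  have above: "f x + g \<bullet> (y - x) \<le> f y" for y
  proof -
    have "g \<bullet> (y - x) \<le> f y - f x"
    proof (rule tendsto_upperbound[OF diff])
      show "eventually (\<lambda>t. (f (x + t *\<^sub>R (y - x)) - f x) / t \<le> f y - f x) (at_right 0)"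
        using small
      proof eventually_elim
        case (elim t)
        then show ?case using f_le[of t y] by (simp add: divide_le_eq mult.commute)
      qed
    qed simp
    then show ?thesis by simp
  qed
  have "convex_fun F"
    unfolding convex_fun_def convex_alt
  proof (intro ballI allI impI)
    fix p q and u :: real assume pq: "p \<in> epi F" "q \<in> epi F" and u: "0 \<le> u \<and> u \<le> 1"
    obtain y r where p: "p = (y, r)" by fastforce
    obtain z s where q: "q = (z, s)" by fastforce
    have e: "F w \<le> ereal c \<longleftrightarrow> h w \<le> ereal (c - f w)" for w c
      unfolding F by (cases "h w") auto
    have "(1 - u) *\<^sub>R (y, r - f y) + u *\<^sub>R (z, s - f z) \<in> epi h"
      using h pq u unfolding convex_fun_def convex_alt
      by (auto simp: epi_def e p q)
    then have "h ((1 - u) *\<^sub>R y + u *\<^sub>R z) \<le> ereal ((1 - u) * (r - f y) + u * (s - f z))"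
      by (simp add: epi_def)
    also have "(1 - u) * (r - f y) + u * (s - f z)
        \<le> ((1 - u) * r + u * s) - f ((1 - u) *\<^sub>R y + u *\<^sub>R z)"
      using convex_onD[OF f, of u y z] u by (simp add: algebra_simps)
    finally show "(1 - u) *\<^sub>R p + u *\<^sub>R q \<in> epi F"
      by (simp add: epi_def e p q)
  qed
  then have eq: "clarke_subdifferential F x = convex_subdifferential F x"
    by (rule clarke_subdifferential_convex)
  have "v \<in> convex_subdifferential F x \<longleftrightarrow> v - g \<in> convex_subdifferential h x" for v
  proof (cases "\<bar>h x\<bar> = \<infinity>")
    case True
    then show ?thesis by (auto simp: convex_subdifferential_def F)
  next
    case False
    then obtain a where a: "h x = ereal a" by (cases "h x") auto
    show ?thesis
    proof
      assume v: "v \<in> convex_subdifferential F x"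
      have "h x + ereal ((v - g) \<bullet> (y - x)) \<le> h y" for y
      proof (rule ereal_le_real)
        fix b assume b: "h y \<le> ereal b"
        have "v \<bullet> (y - x) - (b - a) \<le> g \<bullet> (y - x)"
        proof (rule tendsto_lowerbound[OF diff])
          show "eventually (\<lambda>t. v \<bullet> (y - x) - (b - a) \<le> (f (x + t *\<^sub>R (y - x)) - f x) / t) (at_right 0)"
            using small
          proof eventually_elim
            case (elim t)
            let ?z = "x + t *\<^sub>R (y - x)"
            have "ereal (f x + a + t * (v \<bullet> (y - x))) \<le> F ?z"
              using v by (auto simp: convex_subdifferential_def F a dest: spec[of _ ?z])
            also have "F ?z \<le> ereal (f ?z + (a + t * (b - a)))"
              unfolding F using h_le[of t a y b] elim b a
              by (cases "h ?z") auto
            finally show ?case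
              using elim by (simp add: le_divide_eq algebra_simps)
          qed
        qed simp
        then show "h x + ereal ((v - g) \<bullet> (y - x)) \<le> ereal b"
          by (simp add: a inner_diff_left)
      qed
      then show "v - g \<in> convex_subdifferential h x"
        by (simp add: convex_subdifferential_def a)
    next
      assume v: "v - g \<in> convex_subdifferential h x"
      have "F x + ereal (v \<bullet> (y - x)) \<le> F y" for y
      proof -
        have "ereal (a + (v - g) \<bullet> (y - x)) \<le> h y"
          using v by (auto simp: convex_subdifferential_def a)
        then show ?thesis
          using above[of y] by (cases "h y") (auto simp: F a inner_diff_left)
      qed
      then show "v \<in> convex_subdifferential F x"
        by (simp add: convex_subdifferential_def a F)
    qed
  qed
  note iff = this
  show ?thesis
    unfolding eq
  proof (intro equalityI subsetI)
    fix v assume "v \<in> convex_subdifferential F x"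
    then show "v \<in> (\<lambda>v. g + v) ` convex_subdifferential h x"
      using iff[of v] by (intro image_eqI[where x = "v - g"]) simp_all
  next
    fix v assume "v \<in> (\<lambda>v. g + v) ` convex_subdifferential h x"
    then show "v \<in> convex_subdifferential F x"
      using iff[of v] by (elim imageE) simp
  qed
qed

end

theory Submission imports Defs begin

text \<open>
  Write \<open>d = x\<^sub>1 - x\<^sub>2\<close> for the step and \<open>e = \<nabla>f(x\<^sub>1) - \<nabla>f(x\<^sub>2)\<close> for the change of the gradient.
  The optimality condition of the proximal step says that \<open>d/\<gamma> - \<nabla>f(x\<^sub>1)\<close> is a subgradient of \<open>h\<close>
  at \<open>x\<^sub>2\<close>, so \<open>v = d/\<gamma> - e\<close> belongs to \<open>\<partial>F(x\<^sub>2)\<close>, and the Polyak-Lojasiewicz inequality at \<open>x\<^sub>2\<close> gives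
  \<open>\<parallel>v\<parallel>\<^sup>2 \<ge> 2\<mu> (F(x\<^sub>2) - F\<^sub>*)\<close>. It remains to bound the decrease \<open>F(x\<^sub>1) - F(x\<^sub>2)\<close> from below by a
  multiple \<open>\<tau> \<parallel>v\<parallel>\<^sup>2\<close>; the contraction factor is then \<open>1/(1 + 2\<mu>\<tau>)\<close>
  (\<open>polyak_lojasiewicz_contraction\<close>). Such a bound also yields \<open>F(x\<^sub>2) \<le> F(x\<^sub>1)\<close>, so that \<open>x\<^sub>2\<close> lies in the
  sublevel set on which the Polyak-Lojasiewicz inequality is assumed.

  Adding the subgradient inequality of \<open>h\<close> and the quadratic lower bound for convex functions with
  Lipschitz gradient, both taken at \<open>x\<^sub>2\<close>, gives
  \<open>F(x\<^sub>1) - F(x\<^sub>2) \<ge> \<parallel>d\<parallel>\<^sup>2/\<gamma> - e \<bullet> d + \<parallel>e\<parallel>\<^sup>2/(2L)\<close> (\<open>proximal_gradient_decrease\<close>). The right-hand side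
  and \<open>\<parallel>v\<parallel>\<^sup>2\<close> are quadratic forms in \<open>d\<close> and \<open>e\<close>, which are tied by cocoercivity,
  \<open>e \<bullet> d \<ge> \<parallel>e\<parallel>\<^sup>2/L\<close>. For \<open>\<gamma> \<le> 3/(2L)\<close> one can take \<open>\<tau> = \<gamma>\<close>, and for longer steps
  \<open>\<tau> = \<gamma>(2 - L\<gamma>)/(2(L\<gamma> - 1)\<^sup>2)\<close>: in both cases the difference of the two forms is a nonnegative
  combination of a square and the cocoercivity gap. The two values of \<open>\<tau>\<close> agree at
  \<open>\<gamma> = 3/(2L)\<close>, where the coefficient of the square vanishes in both combinations.

  The proximal point must first be shown to exist. This uses an affine minorant of \<open>h\<close>, and the
  minimizer \<open>z\<close> of \<open>F\<close> supplies one: by Fermat's rule \<open>-\<nabla>f(z)\<close> is a subgradient of \<open>h\<close> at \<open>z\<close>.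
\<close>

section \<open>Convex subdifferentials\<close>

lemma convex_fun_add:
  fixes f :: "'a::euclidean_space \<Rightarrow> real" and h :: "'a \<Rightarrow> ereal"
  assumes f: "convex_on UNIV f" and h: "convex_fun h"
  shows "convex_fun (\<lambda>x. ereal (f x) + h x)"
  unfolding convex_fun_def convex_alt
proof (intro ballI allI impI)
  fix p q and u :: real
  let ?E = "epi (\<lambda>x. ereal (f x) + h x)"
  assume pq: "p \<in> ?E" "q \<in> ?E" and u: "0 \<le> u \<and> u \<le> 1"
  obtain y r where p: "p = (y, r)" by fastforce
  obtain z s where q: "q = (z, s)" by fastforce
  have shift: "ereal (f w) + h w \<le> ereal c \<longleftrightarrow> h w \<le> ereal (c - f w)" for w c
    by (cases "h w") auto
  have "(1 - u) *\<^sub>R (y, r - f y) + u *\<^sub>R (z, s - f z) \<in> epi h"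
    using h pq u unfolding convex_fun_def convex_alt by (auto simp: epi_def shift p q)
  then have "h ((1 - u) *\<^sub>R y + u *\<^sub>R z) \<le> ereal ((1 - u) * (r - f y) + u * (s - f z))"
    by (simp add: epi_def)
  also have "(1 - u) * (r - f y) + u * (s - f z)
      \<le> ((1 - u) * r + u * s) - f ((1 - u) *\<^sub>R y + u *\<^sub>R z)"
    using convex_onD[OF f, of u y z] u by (simp add: algebra_simps)
  finally show "(1 - u) *\<^sub>R p + u *\<^sub>R q \<in> ?E"
    by (simp add: epi_def shift p q)
qed

lemma convex_subdifferential_sum:
  fixes f :: "'a::euclidean_space \<Rightarrow> real" and h :: "'a \<Rightarrow> ereal"
  assumes "convex_on UNIV f" and "GDERIV f x :> g" and "convex_fun h"
  shows "convex_subdifferential (\<lambda>x. ereal (f x) + h x) x = (\<lambda>v. g + v) ` convex_subdifferential h x"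
  using clarke_subdifferential_sum[OF assms, of "\<lambda>x. ereal (f x) + h x"]
    clarke_subdifferential_convex[OF convex_fun_add[OF assms(1,3)]] by simp

text \<open>Fermat's rule for a composite function. It serves twice: at a minimizer of the objective, for an
  affine minorant of \<open>h\<close>, and at the proximal point, for its optimality condition.\<close>

lemma minimizer_neg_gradient_subgradient:
  fixes f :: "'a::euclidean_space \<Rightarrow> real" and h :: "'a \<Rightarrow> ereal"
  assumes "convex_on UNIV f" and "GDERIV f z :> g" and "convex_fun h"
    and fin: "\<bar>h z\<bar> \<noteq> \<infinity>"
    and min: "\<And>y. ereal (f z) + h z \<le> ereal (f y) + h y"
  shows "- g \<in> convex_subdifferential h z"
proof -
  have "0 \<in> convex_subdifferential (\<lambda>x. ereal (f x) + h x) z"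
    using fin min by (auto simp: convex_subdifferential_def zero_ereal_def[symmetric])
  then obtain v where "v \<in> convex_subdifferential h z" "g + v = 0"
    unfolding convex_subdifferential_sum[OF assms(1-3)] by auto
  then show ?thesis
    by (metis add_eq_0_iff)
qed

text \<open>The sum rule with a zero second summand turns the gradient into a convex subgradient.\<close>

lemma convex_on_gradient_inequality:
  fixes f :: "'a::euclidean_space \<Rightarrow> real"
  assumes "convex_on UNIV f" and "GDERIV f x :> g"
  shows "f x + g \<bullet> (y - x) \<le> f y"
proof -
  have "convex_fun (\<lambda>_::'a. 0 :: ereal)"
  proof -
    have "epi (\<lambda>_::'a. 0 :: ereal) = UNIV \<times> {0..}"
      by (auto simp: epi_def)
    then show ?thesis
      by (simp add: convex_fun_def convex_Times)
  qed
  moreover have "0 \<in> convex_subdifferential (\<lambda>_::'a. 0 :: ereal) x"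
    by (simp add: convex_subdifferential_def)
  ultimately have "g \<in> convex_subdifferential (\<lambda>x. ereal (f x) + 0) x"
    by (subst convex_subdifferential_sum[OF assms]) (auto intro: image_eqI[where x = 0])
  then show ?thesis
    by (simp add: convex_subdifferential_def)
qed

section \<open>Convex functions with Lipschitz gradient\<close>

text \<open>Along the segment from \<open>x\<close> to \<open>y\<close>, the Lipschitz condition makes the derivative of the left-hand
  side at most that of the right-hand side.\<close>

lemma lipschitz_gradient_upper_bound:
  fixes f :: "'a::euclidean_space \<Rightarrow> real" and G :: "'a \<Rightarrow> 'a"
  assumes grad: "\<And>x. GDERIV f x :> G x" and lip: "L-lipschitz_on UNIV G"
  shows "f y \<le> f x + G x \<bullet> (y - x) + L / 2 * (norm (y - x))\<^sup>2"
proof -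
  define d where "d = y - x"
  define \<phi> where "\<phi> t = f (x + t *\<^sub>R d) - t * (G x \<bullet> d) - L / 2 * t\<^sup>2 * (norm d)\<^sup>2" for t
  have line: "((\<lambda>t. f (x + t *\<^sub>R d)) has_field_derivative (G (x + t *\<^sub>R d) \<bullet> d)) (at t)" for t
  proof -
    have 1: "((\<lambda>t. x + t *\<^sub>R d) has_derivative (\<lambda>s. s *\<^sub>R d)) (at t)"
      by (auto intro!: derivative_eq_intros)
    have 2: "(f has_derivative (\<lambda>k. k \<bullet> G (x + t *\<^sub>R d))) (at (x + t *\<^sub>R d))"
      using grad by (simp add: gderiv_def inner_commute)
    show ?thesis
      unfolding has_field_derivative_def
      by (rule has_derivative_eq_rhs[OF has_derivative_compose[OF 1 2]]) (auto simp: inner_commute)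
  qed
  have "\<phi> 1 \<le> \<phi> 0"
  proof (rule DERIV_nonpos_imp_nonincreasing[where f = \<phi>])
    fix t :: real assume t: "0 \<le> t" "t \<le> 1"
    have "(G (x + t *\<^sub>R d) - G x) \<bullet> d \<le> norm (G (x + t *\<^sub>R d) - G x) * norm d"
      by (rule norm_cauchy_schwarz)
    also have "\<dots> \<le> (L * norm (t *\<^sub>R d)) * norm d"
      using lipschitz_onD[OF lip, of "x + t *\<^sub>R d" x] by (intro mult_right_mono) (auto simp: dist_norm)
    also have "\<dots> = L * t * (norm d)\<^sup>2"
      using t by (simp add: power2_eq_square)
    finally have "G (x + t *\<^sub>R d) \<bullet> d - G x \<bullet> d - L * t * (norm d)\<^sup>2 \<le> 0"
      by (simp add: inner_diff_left)
    moreover have "(\<phi> has_field_derivative (G (x + t *\<^sub>R d) \<bullet> d - G x \<bullet> d - L * t * (norm d)\<^sup>2)) (at t)"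
      unfolding \<phi>_def by (auto intro!: derivative_eq_intros line)
    ultimately show "\<exists>D. (\<phi> has_field_derivative D) (at t) \<and> D \<le> 0"
      by blast
  qed simp
  then show ?thesis
    by (simp add: \<phi>_def d_def)
qed

text \<open>The point \<open>w\<close> is a gradient step from \<open>y\<close> for the function \<open>f - G x \<bullet> _\<close>, which is minimal at \<open>x\<close>.
  The step lowers this function by at least \<open>\<parallel>G y - G x\<parallel>\<^sup>2/(2L)\<close>, yet not below the minimum.\<close>

lemma convex_lipschitz_gradient_lower_bound:
  fixes f :: "'a::euclidean_space \<Rightarrow> real" and G :: "'a \<Rightarrow> 'a"
  assumes L: "L > 0" and conv: "convex_on UNIV f"
    and grad: "\<And>x. GDERIV f x :> G x" and lip: "L-lipschitz_on UNIV G"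
  shows "f x + G x \<bullet> (y - x) + (norm (G y - G x))\<^sup>2 / (2 * L) \<le> f y"
proof -
  define e where "e = G y - G x"
  define w where "w = y - (1 / L) *\<^sub>R e"
  have "f x + G x \<bullet> (w - x) \<le> f w"
    by (rule convex_on_gradient_inequality[OF conv grad])
  also have "\<dots> \<le> f y + G y \<bullet> (w - y) + L / 2 * (norm (w - y))\<^sup>2"
    by (rule lipschitz_gradient_upper_bound[OF grad lip])
  finally have "f x + G x \<bullet> (y - x) + ((G y - G x) \<bullet> (y - w) - L / 2 * (norm (w - y))\<^sup>2) \<le> f y"
    by (simp add: inner_diff_left inner_diff_right)
  moreover have "(G y - G x) \<bullet> (y - w) = (norm e)\<^sup>2 / L"
    by (simp add: w_def e_def[symmetric] power2_norm_eq_inner)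
  moreover have "L / 2 * (norm (w - y))\<^sup>2 = (norm e)\<^sup>2 / (2 * L)"
    using L by (simp add: w_def power_divide power2_eq_square)
  ultimately show ?thesis
    using L by (simp add: e_def field_simps)
qed

text \<open>The lower bound from \<open>x\<close> to \<open>y\<close> plus the one from \<open>y\<close> to \<open>x\<close>.\<close>

lemma gradient_cocoercive:
  fixes f :: "'a::euclidean_space \<Rightarrow> real" and G :: "'a \<Rightarrow> 'a"
  assumes "L > 0" and "convex_on UNIV f"
    and "\<And>x. GDERIV f x :> G x" and "L-lipschitz_on UNIV G"
  shows "(norm (G x - G y))\<^sup>2 / L \<le> (G x - G y) \<bullet> (x - y)"
  using convex_lipschitz_gradient_lower_bound[OF assms, of x y]
    convex_lipschitz_gradient_lower_bound[OF assms, of y x] \<open>L > 0\<close>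
  by (simp add: inner_diff_left inner_diff_right norm_minus_commute field_simps)

section \<open>The proximal operator\<close>

text \<open>The proximal objective at \<open>y\<close> is the infimum of \<open>\<psi> (y, r) = r + \<parallel>y - x\<parallel>\<^sup>2/2\<close> over the points
  \<open>(y, r)\<close> of the epigraph. On the closed epigraph the continuous \<open>\<psi>\<close> attains its minimum because its
  sublevel sets there are bounded: the subgradient \<open>v\<close> gives an affine minorant of \<open>g\<close>, which the
  quadratic term dominates. Working in the epigraph replaces lower semicontinuity by
  closedness of a set.\<close>

lemma prox_minimizes:
  fixes g :: "'a::euclidean_space \<Rightarrow> ereal"
  assumes closed: "closed_fun g" and fin: "\<And>y. g y \<noteq> -\<infinity>"
    and v: "v \<in> convex_subdifferential g z"
  shows "g (prox g x) + ereal (1/2 * (norm (prox g x - x))\<^sup>2) \<le> g y + ereal (1/2 * (norm (y - x))\<^sup>2)"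
proof -
  obtain c where c: "g z = ereal c"
    using v by (cases "g z") (auto simp: convex_subdifferential_def)
  define \<psi> where "\<psi> p = snd p + 1/2 * (norm (fst p - x))\<^sup>2" for p :: "'a \<times> real"
  define M where "M = \<psi> (z, c)"
  define R where "R = norm (z - (x - v))"
  define K where "K = epi g \<inter> {p. \<psi> p \<le> M}"
  have cont: "continuous_on S \<psi>" for S
    unfolding \<psi>_def by (intro continuous_intros)
  have "K \<subseteq> cball (x - v) R \<times> {c - 2 * norm v * R .. M}"
  proof
    fix p assume p: "p \<in> K"
    obtain y r where yr: "p = (y, r)" by fastforce
    have "g y \<le> ereal r" and le: "r + 1/2 * (norm (y - x))\<^sup>2 \<le> c + 1/2 * (norm (z - x))\<^sup>2"
      using p by (auto simp: K_def epi_def \<psi>_def M_def yr)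
    moreover have "ereal (c + v \<bullet> (y - z)) \<le> g y"
      using v by (simp add: convex_subdifferential_def c)
    ultimately have r: "c + v \<bullet> (y - z) \<le> r"
      by (metis ereal_less_eq(3) order_trans)
    \<comment> \<open>completing the square in \<open>v \<bullet> (y - z) + (norm (y - x))\<^sup>2 / 2 \<le> (norm (z - x))\<^sup>2 / 2\<close>\<close>
    have "(norm (y - (x - v)))\<^sup>2 \<le> R\<^sup>2"
      using r le unfolding R_def power2_norm_eq_inner
      by (simp add: inner_diff_left inner_diff_right inner_commute algebra_simps)
    then have y: "norm (y - (x - v)) \<le> R"
      by (rule power2_le_imp_le) (simp add: R_def)
    have "norm (y - z) \<le> 2 * R"
      using norm_triangle_ineq4[of "y - (x - v)" "z - (x - v)"] y by (simp add: R_def)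
    then have "norm v * norm (y - z) \<le> norm v * (2 * R)"
      by (rule mult_left_mono) simp
    moreover have "- (v \<bullet> (y - z)) \<le> norm v * norm (y - z)"
      using norm_cauchy_schwarz[of "- v" "y - z"] by simp
    ultimately have "c - 2 * norm v * R \<le> r"
      using r by simp
    moreover have "r \<le> M"
      using le zero_le_power2[of "norm (y - x)"] unfolding M_def \<psi>_def fst_conv snd_conv by linarith
    ultimately show "p \<in> cball (x - v) R \<times> {c - 2 * norm v * R .. M}"
      using y by (simp add: yr dist_norm norm_minus_commute)
  qed
  then have "bounded K"
    by (rule bounded_subset[rotated]) (intro bounded_Times bounded_cball bounded_closed_interval)
  moreover have "closed K"
    unfolding K_def using closed cont
    by (intro closed_Int closed_Collect_le) (auto simp: closed_fun_def)
  ultimately have "compact K"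
    by (simp add: compact_eq_bounded_closed)
  moreover have zK: "(z, c) \<in> K"
    by (simp add: K_def M_def epi_def c)
  ultimately obtain p where p: "p \<in> K" "\<And>q. q \<in> K \<Longrightarrow> \<psi> p \<le> \<psi> q"
    using continuous_attains_inf[OF _ _ cont] by (metis empty_iff)
  obtain y0 r0 where p0: "p = (y0, r0)" by fastforce
  have "g y0 + ereal (1/2 * (norm (y0 - x))\<^sup>2) \<le> g y + ereal (1/2 * (norm (y - x))\<^sup>2)" for y
  proof (cases "g y")
    case (real r)
    have "\<psi> p \<le> \<psi> (y, r)"
    proof (cases "(y, r) \<in> K")
      case False
      then have "M < \<psi> (y, r)"
        using real by (auto simp: K_def epi_def)
      then show ?thesis
        using p(1) by (simp add: K_def)
    qed (rule p(2))
    moreover have "g y0 \<le> ereal r0"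
      using p(1) by (simp add: K_def epi_def p0)
    ultimately show ?thesis
      using fin[of y0] by (cases "g y0") (auto simp: real \<psi>_def p0)
  qed (use fin in auto)
  then have "\<exists>y. is_arg_min (\<lambda>y. g y + ereal (1/2 * (norm (y - x))\<^sup>2)) (\<lambda>_. True) y"
    by (intro exI[of _ y0]) (auto simp: is_arg_min_def not_less)
  then have "is_arg_min (\<lambda>y. g y + ereal (1/2 * (norm (y - x))\<^sup>2)) (\<lambda>_. True) (prox g x)"
    unfolding prox_def arg_min_def by (rule someI_ex)
  then show ?thesis
    by (simp add: is_arg_min_def not_less)
qed

text \<open>Fermat's rule for the proximal objective, whose smooth part has the gradient \<open>y - x\<close> at \<open>y\<close>.\<close>

lemma prox_subgradient:
  fixes g :: "'a::euclidean_space \<Rightarrow> ereal"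
  assumes "closed_fun g" and conv: "convex_fun g" and fin: "\<And>y. g y \<noteq> -\<infinity>"
    and v: "v \<in> convex_subdifferential g z"
  shows "x - prox g x \<in> convex_subdifferential g (prox g x)"
proof -
  let ?q = "\<lambda>y. 1/2 * (norm (y - x))\<^sup>2"
  let ?p = "prox g x"
  have min: "ereal (?q ?p) + g ?p \<le> ereal (?q y) + g y" for y
    using prox_minimizes[OF assms(1) fin v, of x y] by (simp add: add.commute)
  have "convex_on UNIV (\<lambda>y. (norm (y - x))\<^sup>2)"
  proof (rule convex_onI)
    fix t :: real and a b assume t: "0 < t" "t < 1"
    have "(1 - t) * (norm (a - x))\<^sup>2 + t * (norm (b - x))\<^sup>2 - (norm ((1 - t) *\<^sub>R a + t *\<^sub>R b - x))\<^sup>2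
        = t * (1 - t) * (norm (a - b))\<^sup>2"
      unfolding power2_norm_eq_inner
      by (simp add: inner_diff_left inner_diff_right inner_add_left inner_add_right inner_commute
          algebra_simps)
    also have "\<dots> \<ge> 0"
      using t by simp
    finally show "(norm ((1 - t) *\<^sub>R a + t *\<^sub>R b - x))\<^sup>2 \<le> (1 - t) * (norm (a - x))\<^sup>2 + t * (norm (b - x))\<^sup>2"
      by simp
  qed simp
  then have "convex_on UNIV ?q"
    by (intro convex_on_cmul) auto
  moreover have "GDERIV ?q ?p :> ?p - x"
    unfolding gderiv_def power2_norm_eq_inner
    by (auto intro!: derivative_eq_intros simp: inner_commute)
  moreover have "\<bar>g ?p\<bar> \<noteq> \<infinity>"
  proof -
    have "g z \<noteq> \<infinity>"
      using v by (auto simp: convex_subdifferential_def)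
    then show ?thesis
      using min[of z] fin[of ?p] by (cases "g ?p"; cases "g z") auto
  qed
  ultimately have "- (?p - x) \<in> convex_subdifferential g ?p"
    using conv min by (intro minimizer_neg_gradient_subgradient)
  then show ?thesis
    by simp
qed

text \<open>A proximal gradient step uses the proximal operator of \<open>\<gamma> h\<close>. Scaling by \<open>\<gamma> > 0\<close> acts on the
  epigraph by a linear isomorphism, which transports closedness and convexity.\<close>

lemma epi_scale:
  assumes "\<gamma> > 0"
  shows "epi (\<lambda>y. ereal \<gamma> * h y) = (\<lambda>p. (fst p, (1 / \<gamma>) *\<^sub>R snd p)) -` epi h"
proof -
  have "ereal \<gamma> * h y \<le> ereal r \<longleftrightarrow> h y \<le> ereal (r / \<gamma>)" for y r
    using assms by (cases "h y") (auto simp: field_simps)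
  then show ?thesis
    by (auto simp: epi_def)
qed

lemma closed_fun_scale:
  assumes "\<gamma> > 0" and "closed_fun h"
  shows "closed_fun (\<lambda>y. ereal \<gamma> * h y)"
  using assms(2) unfolding closed_fun_def epi_scale[OF assms(1)]
  by (rule closed_vimage) (intro continuous_intros)

lemma convex_fun_scale:
  assumes "\<gamma> > 0" and "convex_fun h"
  shows "convex_fun (\<lambda>y. ereal \<gamma> * h y)"
  unfolding convex_fun_def epi_scale[OF assms(1)]
proof (rule convex_linear_vimage)
  show "linear (\<lambda>p. (fst p, (1 / \<gamma>) *\<^sub>R snd p))"
    by (rule linearI) (auto simp: algebra_simps add_divide_distrib)
qed (use assms(2) in \<open>simp add: convex_fun_def\<close>)

lemma convex_subdifferential_scale:
  assumes "\<gamma> > 0"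
  shows "\<gamma> *\<^sub>R v \<in> convex_subdifferential (\<lambda>y. ereal \<gamma> * h y) x \<longleftrightarrow> v \<in> convex_subdifferential h x"
proof (cases "h x")
  case (real a)
  have "ereal \<gamma> * h x + ereal (\<gamma> *\<^sub>R v \<bullet> (y - x)) \<le> ereal \<gamma> * h y
      \<longleftrightarrow> h x + ereal (v \<bullet> (y - x)) \<le> h y" for y
  proof (cases "h y")
    case (real b)
    have "\<gamma> * a + \<gamma> * (v \<bullet> (y - x)) \<le> \<gamma> * b \<longleftrightarrow> a + v \<bullet> (y - x) \<le> b"
      using assms by (simp flip: distrib_left)
    then show ?thesis
      by (simp add: real \<open>h x = ereal a\<close>)
  qed (use assms real in auto)
  then show ?thesis
    by (simp add: convex_subdifferential_def real)
qed (use assms in \<open>auto simp: convex_subdifferential_def\<close>)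

section \<open>Sufficient decrease of a proximal gradient step\<close>

text \<open>The slack is the cocoercivity gap plus \<open>(3/(2L) - \<gamma>) \<parallel>e\<parallel>\<^sup>2\<close>; the sign of the last coefficient is
  what limits the step size.\<close>

lemma decrease_dominates_short_step:
  fixes d e :: "'a::real_inner"
  assumes L: "L > 0" and \<gamma>: "\<gamma> > 0" "\<gamma> \<le> 3 / (2 * L)"
    and coco: "(norm e)\<^sup>2 / L \<le> e \<bullet> d"
  shows "\<gamma> * (norm ((1 / \<gamma>) *\<^sub>R d - e))\<^sup>2 \<le> (norm d)\<^sup>2 / \<gamma> - e \<bullet> d + (norm e)\<^sup>2 / (2 * L)"
proof -
  have "(norm d)\<^sup>2 / \<gamma> - e \<bullet> d + (norm e)\<^sup>2 / (2 * L) - \<gamma> * (norm ((1 / \<gamma>) *\<^sub>R d - e))\<^sup>2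
      = (e \<bullet> d - (norm e)\<^sup>2 / L) + (3 / (2 * L) - \<gamma>) * (norm e)\<^sup>2"
    using L \<gamma> unfolding power2_norm_eq_inner
    by (simp add: inner_diff_left inner_diff_right inner_commute field_simps)
  also have "\<dots> \<ge> 0"
    using coco \<gamma> by (intro add_nonneg_nonneg mult_nonneg_nonneg) auto
  finally show ?thesis
    by simp
qed

text \<open>With \<open>t = L\<gamma>\<close> and after multiplication by \<open>(t - 1)\<^sup>2\<close>, the slack is
  \<open>L (t - 3/2) \<parallel>d - e/L\<parallel>\<^sup>2 + (t - 1)(2 - t) (e \<bullet> d - \<parallel>e\<parallel>\<^sup>2/L)\<close>. It vanishes at \<open>d = e/L\<close>, and this
  determines the constant: no larger multiple of \<open>\<parallel>d/\<gamma> - e\<parallel>\<^sup>2\<close> is possible there.\<close>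

lemma decrease_dominates_long_step:
  fixes d e :: "'a::real_inner"
  assumes L: "L > 0" and \<gamma>: "\<gamma> > 3 / (2 * L)" "\<gamma> < 2 / L"
    and coco: "(norm e)\<^sup>2 / L \<le> e \<bullet> d"
  shows "\<gamma> * (2 - L * \<gamma>) / (2 * (L * \<gamma> - 1)\<^sup>2) * (norm ((1 / \<gamma>) *\<^sub>R d - e))\<^sup>2
      \<le> (norm d)\<^sup>2 / \<gamma> - e \<bullet> d + (norm e)\<^sup>2 / (2 * L)"
proof -
  define t where "t = L * \<gamma>"
  have t: "3 / 2 < t" "t < 2"
    using L \<gamma> by (auto simp: t_def field_simps)
  have \<gamma>_pos: "\<gamma> > 0"
    using L \<gamma>(1) by (smt (verit) divide_pos_pos)
  have \<gamma>_eq: "\<gamma> = t / L"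
    using L by (simp add: t_def)
  have "(t - 1)\<^sup>2 * ((norm d)\<^sup>2 / \<gamma> - e \<bullet> d + (norm e)\<^sup>2 / (2 * L))
        - \<gamma> * (2 - t) / 2 * (norm ((1 / \<gamma>) *\<^sub>R d - e))\<^sup>2
      = L * (t - 3 / 2) * (norm (d - (1 / L) *\<^sub>R e))\<^sup>2 + (t - 1) * (2 - t) * (e \<bullet> d - (norm e)\<^sup>2 / L)"
    using L t unfolding power2_norm_eq_inner \<gamma>_eq
    by (simp add: inner_diff_left inner_diff_right inner_commute field_simps power2_eq_square)
  also have "\<dots> \<ge> 0"
    using coco t L by (intro add_nonneg_nonneg mult_nonneg_nonneg) auto
  finally have "\<gamma> * (2 - t) / 2 * (norm ((1 / \<gamma>) *\<^sub>R d - e))\<^sup>2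
      \<le> (t - 1)\<^sup>2 * ((norm d)\<^sup>2 / \<gamma> - e \<bullet> d + (norm e)\<^sup>2 / (2 * L))"
    by simp
  moreover have "(t - 1)\<^sup>2 > 0"
    using t by simp
  ultimately show ?thesis
    by (simp add: t_def[symmetric] field_simps)
qed

section \<open>Linear convergence under the Polyak-Lojasiewicz inequality\<close>

lemma dist_zero_square_le:
  assumes "v \<in> S"
  shows "(dist_zero S)\<^sup>2 \<le> ereal ((norm v)\<^sup>2)"
proof -
  have "dist_zero S \<le> ereal (norm v)"
    unfolding dist_zero_def using assms by (rule INF_lower)
  moreover have "0 \<le> dist_zero S"
    unfolding dist_zero_def by (rule INF_greatest) simp
  ultimately show ?thesis
    by (cases "dist_zero S") auto
qed

text \<open>The subgradient inequality of \<open>h\<close> and the quadratic lower bound for \<open>f\<close>, both based at the new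
  point \<open>x2\<close>, are added; the terms in \<open>G x1\<close> and \<open>G x2\<close> combine to \<open>(G x1 - G x2) \<bullet> (x1 - x2)\<close>.\<close>

lemma proximal_gradient_decrease:
  fixes f :: "'a::euclidean_space \<Rightarrow> real" and G :: "'a \<Rightarrow> 'a" and h :: "'a \<Rightarrow> ereal"
  assumes "L > 0" and "convex_on UNIV f"
    and "\<And>x. GDERIV f x :> G x" and "L-lipschitz_on UNIV G"
    and \<gamma>: "\<gamma> > 0"
    and sub: "(1 / \<gamma>) *\<^sub>R (x1 - x2) - G x1 \<in> convex_subdifferential h x2"
    and h1: "h x1 = ereal a1" and h2: "h x2 = ereal a2"
  shows "(norm (x1 - x2))\<^sup>2 / \<gamma> - (G x1 - G x2) \<bullet> (x1 - x2) + (norm (G x1 - G x2))\<^sup>2 / (2 * L)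
      \<le> (f x1 + a1) - (f x2 + a2)"
proof -
  have "h x2 + ereal (((1 / \<gamma>) *\<^sub>R (x1 - x2) - G x1) \<bullet> (x1 - x2)) \<le> h x1"
    using sub by (simp add: convex_subdifferential_def)
  then have "a2 + ((1 / \<gamma>) *\<^sub>R (x1 - x2) - G x1) \<bullet> (x1 - x2) \<le> a1"
    by (simp add: h1 h2)
  then have "a2 + (norm (x1 - x2))\<^sup>2 / \<gamma> - G x1 \<bullet> (x1 - x2) \<le> a1"
    by (simp add: inner_diff_left[of "(1 / \<gamma>) *\<^sub>R (x1 - x2)"] power2_norm_eq_inner)
  moreover have "f x2 + G x2 \<bullet> (x1 - x2) + (norm (G x1 - G x2))\<^sup>2 / (2 * L) \<le> f x1"
    by (rule convex_lipschitz_gradient_lower_bound[OF assms(1-4)])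
  ultimately show ?thesis
    by (simp add: inner_diff_left[of "G x1"])
qed

text \<open>A decrease by \<open>\<tau> \<parallel>v\<parallel>\<^sup>2\<close> is at least \<open>2\<mu>\<tau>\<close> times the new gap \<open>F x2 - m\<close>, because \<open>\<parallel>v\<parallel>\<close> is at
  least the distance from the origin to the subdifferential at \<open>x2\<close>.\<close>

lemma polyak_lojasiewicz_contraction:
  fixes F :: "'a::euclidean_space \<Rightarrow> ereal"
  assumes "\<mu> > 0" and \<tau>: "\<tau> \<ge> 0"
    and F1: "F x1 = ereal b1" and F2: "F x2 = ereal b2"
    and v: "v \<in> clarke_subdifferential F x2"
    and decr: "\<tau> * (norm v)\<^sup>2 \<le> b1 - b2"
    and PL: "F x2 \<le> F x1 \<Longrightarrow> (dist_zero (clarke_subdifferential F x2))\<^sup>2 \<ge> ereal (2 * \<mu>) * (F x2 - ereal m)"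
  shows "F x2 - ereal m \<le> ereal (1 / (1 + 2 * \<mu> * \<tau>)) * (F x1 - ereal m)"
proof -
  have "0 \<le> \<tau> * (norm v)\<^sup>2"
    using \<tau> by simp
  then have "F x2 \<le> F x1"
    using decr by (simp add: F1 F2)
  then have "ereal (2 * \<mu>) * (F x2 - ereal m) \<le> ereal ((norm v)\<^sup>2)"
    using PL dist_zero_square_le[OF v] order_trans by blast
  then have "2 * \<mu> * (b2 - m) \<le> (norm v)\<^sup>2"
    by (simp add: F2)
  then have "\<tau> * (2 * \<mu> * (b2 - m)) \<le> b1 - b2"
    using decr mult_left_mono[OF _ \<tau>] by fastforce
  then have "(1 + 2 * \<mu> * \<tau>) * (b2 - m) \<le> b1 - m"
    by (simp add: algebra_simps)
  moreover have "1 + 2 * \<mu> * \<tau> > 0"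
    using assms(1) \<tau> by (simp add: add_pos_nonneg)
  ultimately have "b2 - m \<le> (b1 - m) / (1 + 2 * \<mu> * \<tau>)"
    by (simp add: pos_le_divide_eq mult.commute)
  then show ?thesis
    by (simp add: F1 F2)
qed

theorem theorem3:
  fixes f :: "'a::euclidean_space \<Rightarrow> real" and grad_f :: "'a \<Rightarrow> 'a"
    and h F :: "'a \<Rightarrow> ereal" and F_star :: ereal
    and L \<mu> \<gamma> :: real and x1 x2 :: 'a
  assumes "L > 0" and "\<mu> > 0"
    and "convex_on UNIV f"
    and "\<And>x. GDERIV f x :> grad_f x"
    and "L-lipschitz_on UNIV grad_f"
    and "closed_fun h" and "proper_fun h" and "convex_fun h"
    and "\<And>x. F x = ereal (f x) + h x"
    and "\<exists>z. F z = F_star" and "\<And>x. F_star \<le> F x"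
    and "\<And>x. F x \<le> F x1 \<Longrightarrow>
           (dist_zero (clarke_subdifferential F x))\<^sup>2 \<ge> ereal (2 * \<mu>) * (F x - F_star)"
    and "0 < \<gamma>" and "\<gamma> < 2 / L"
    and "x2 = prox (\<lambda>y. ereal \<gamma> * h y) (x1 - \<gamma> *\<^sub>R grad_f x1)"
  shows "(\<gamma> \<le> 3 / (2 * L) \<longrightarrow>
            F x2 - F_star \<le> ereal (1 / (2 * \<gamma> * \<mu> + 1)) * (F x1 - F_star)) \<and>
         (\<gamma> > 3 / (2 * L) \<longrightarrow>
            F x2 - F_star \<le>
              ereal ((L * \<gamma> - 1)\<^sup>2 / ((L * \<gamma> - 1)\<^sup>2 - L * \<gamma>\<^sup>2 * \<mu> + 2 * \<gamma> * \<mu>)) * (F x1 - F_star))"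
proof -
  note f = \<open>convex_on UNIV f\<close> and grad = assms(4) and lip = assms(5) and h = \<open>convex_fun h\<close>
    and F = assms(9) and PL = assms(12)
  \<comment> \<open>the two factors of the claim are both of the form \<open>1 / (1 + 2 * \<mu> * \<tau>)\<close>\<close>
  define \<tau> where "\<tau> = (if \<gamma> \<le> 3 / (2 * L) then \<gamma> else \<gamma> * (2 - L * \<gamma>) / (2 * (L * \<gamma> - 1)\<^sup>2))"
  have t2: "L * \<gamma> < 2"
    using assms(1,14) by (simp add: field_simps)
  have \<tau>: "\<tau> \<ge> 0"
    using t2 assms(13) by (simp add: \<tau>_def)
  have h_ninf: "h y \<noteq> -\<infinity>" for y
    using assms(7) by (auto simp: proper_fun_def)
  obtain z where z: "F z = F_star"
    using assms(10) by blast
  obtain w where "h w \<noteq> \<infinity>"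
    using assms(7) by (auto simp: proper_fun_def)
  then have hz: "\<bar>h z\<bar> \<noteq> \<infinity>"
    using assms(11)[of w] h_ninf[of z] h_ninf[of w] unfolding z[symmetric] F
    by (cases "h z"; cases "h w") auto
  obtain m where m: "F_star = ereal m"
    using hz unfolding z[symmetric] F by (cases "h z") auto
  have "- grad_f z \<in> convex_subdifferential h z"
    using assms(11) by (intro minimizer_neg_gradient_subgradient[OF f grad h hz]) (simp flip: F z)
  then have "\<gamma> *\<^sub>R (- grad_f z) \<in> convex_subdifferential (\<lambda>y. ereal \<gamma> * h y) z"
    by (simp only: convex_subdifferential_scale[OF assms(13)])
  moreover have "ereal \<gamma> * h y \<noteq> -\<infinity>" for y
    using h_ninf[of y] assms(13) by (cases "h y") auto
  ultimately have "x1 - \<gamma> *\<^sub>R grad_f x1 - x2 \<in> convex_subdifferential (\<lambda>y. ereal \<gamma> * h y) x2"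
    unfolding assms(15)
    using closed_fun_scale[OF assms(13,6)] convex_fun_scale[OF assms(13) h] by (intro prox_subgradient)
  also have "x1 - \<gamma> *\<^sub>R grad_f x1 - x2 = \<gamma> *\<^sub>R ((1 / \<gamma>) *\<^sub>R (x1 - x2) - grad_f x1)"
    using assms(13) by (simp add: scaleR_diff_right)
  finally have sub: "(1 / \<gamma>) *\<^sub>R (x1 - x2) - grad_f x1 \<in> convex_subdifferential h x2"
    by (simp only: convex_subdifferential_scale[OF assms(13)])
  obtain a2 where a2: "h x2 = ereal a2"
    using sub by (cases "h x2") (auto simp: convex_subdifferential_def)
  define v where "v = (1 / \<gamma>) *\<^sub>R (x1 - x2) - (grad_f x1 - grad_f x2)"
  have v: "v \<in> clarke_subdifferential F x2"
    unfolding clarke_subdifferential_sum[OF f grad h F]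
    using sub by (rule image_eqI[rotated]) (simp add: v_def)
  have main: "F x2 - F_star \<le> ereal (1 / (1 + 2 * \<mu> * \<tau>)) * (F x1 - F_star)"
  proof (cases "h x1")
    case (real a1)
    have coco: "(norm (grad_f x1 - grad_f x2))\<^sup>2 / L \<le> (grad_f x1 - grad_f x2) \<bullet> (x1 - x2)"
      by (rule gradient_cocoercive[OF assms(1) f grad lip])
    have "\<tau> * (norm v)\<^sup>2 \<le> (norm (x1 - x2))\<^sup>2 / \<gamma> - (grad_f x1 - grad_f x2) \<bullet> (x1 - x2)
        + (norm (grad_f x1 - grad_f x2))\<^sup>2 / (2 * L)"
      using decrease_dominates_short_step[OF assms(1,13) _ coco]
        decrease_dominates_long_step[OF assms(1) _ assms(14) coco]
      by (simp add: \<tau>_def v_def)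
    also have "\<dots> \<le> (f x1 + a1) - (f x2 + a2)"
      by (rule proximal_gradient_decrease[OF assms(1) f grad lip assms(13) sub real a2])
    finally show ?thesis
      unfolding m
      by (intro polyak_lojasiewicz_contraction[OF assms(2) \<tau> _ _ v])
        (use PL[of x2] in \<open>simp_all add: F real a2 m\<close>)
  next
    case PInf
    \<comment> \<open>outside the domain of \<open>h\<close> the right-hand side is infinite, as its factor is positive\<close>
    have "1 / (1 + 2 * \<mu> * \<tau>) > 0"
      using assms(2) \<tau> by (simp add: add_pos_nonneg)
    then show ?thesis
      by (simp add: F PInf m)
  qed (use h_ninf in simp)
  show ?thesis
  proof (intro conjI impI)
    assume "\<gamma> \<le> 3 / (2 * L)"
    then show "F x2 - F_star \<le> ereal (1 / (2 * \<gamma> * \<mu> + 1)) * (F x1 - F_star)"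
      using main by (simp add: \<tau>_def mult_ac add.commute)
  next
    assume long: "\<gamma> > 3 / (2 * L)"
    define A where "A = (L * \<gamma> - 1)\<^sup>2"
    have "L * \<gamma> > 3 / 2"
      using long assms(1) by (simp add: field_simps)
    then have A: "A > 0"
      by (simp add: A_def)
    have "2 * \<mu> * \<tau> = (2 * \<gamma> * \<mu> - L * \<gamma>\<^sup>2 * \<mu>) / A"
      using long A by (simp add: \<tau>_def flip: A_def) (simp add: field_simps power2_eq_square)
    then have "1 + 2 * \<mu> * \<tau> = (A - L * \<gamma>\<^sup>2 * \<mu> + 2 * \<gamma> * \<mu>) / A"
      using A by (simp add: field_simps)
    then have "1 / (1 + 2 * \<mu> * \<tau>) = A / (A - L * \<gamma>\<^sup>2 * \<mu> + 2 * \<gamma> * \<mu>)"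
      by simp
    then show "F x2 - F_star \<le>
        ereal ((L * \<gamma> - 1)\<^sup>2 / ((L * \<gamma> - 1)\<^sup>2 - L * \<gamma>\<^sup>2 * \<mu> + 2 * \<gamma> * \<mu>)) * (F x1 - F_star)"
      using main by (simp only: A_def)
  qed
qed

end
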